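(* Let $n \ge 2$, and let $r, s$ be nonzero integers with $r > 0$ and $\gcd(r,s) = 1$. Consider the Diophantine equation $$ r\left(\sum_{i=1}^n \frac{1}{x_i}\right) = \frac{s}{x_1 x_2 \cdots x_n} $$ in nonzero integers $x_1,\dots,x_n$. Then: (1) If $r > 1$, this equation has no integer solutions. (2) If $r = 1$, this equation has infinitely many integer solutions; moreover, it has infinitely many integer solutions with $\min_i\{|x_i|\} \ge 2$. *)

theory Defs
  imports Complex_Main "HOL-Library.FuncSet"
begin

text \<open>
  Solutions of \<open>r * (1/x\<^sub>1 + \<dots> + 1/x\<^sub>n) = s / (x\<^sub>1 \<cdots> x\<^sub>n)\<close> in nonzero integers.
  A tuple is an extensional function on \<open>{1..n}\<close>, so distinct functions are distinct tuples
  and cardinality statements about this set count tuples. The equation is read over \<open>rat\<close>;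
  nonvanishing of the entries keeps the convention \<open>a / 0 = 0\<close> from playing any role.
\<close>
definition solutions :: "nat \<Rightarrow> int \<Rightarrow> int \<Rightarrow> (nat \<Rightarrow> int) set" where
  "solutions n r s =
    {x \<in> {1..n} \<rightarrow>\<^sub>E (UNIV - {0}).
       of_int r * (\<Sum>i=1..n. 1 / of_int (x i)) = (of_int s / (\<Prod>i=1..n. of_int (x i)) :: rat)}"

end

theory Submission
  imports Defs
begin

text \<open>
  Clearing denominators turns the equation into \<open>r * e\<^sub>n\<^sub>-\<^sub>1(x) = s\<close> with an elementary symmetric
  polynomial, so \<open>r\<close> divides \<open>s\<close> and hence \<open>r = 1\<close>. If \<open>(x\<^sub>1, \<dots>, x\<^sub>n)\<close> is a solution for
  \<open>r = s = 1\<close> with product \<open>P\<close>, then appending \<open>s - P\<close> gives a solution in \<open>n + 1\<close> variables for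
  \<open>r = 1\<close> and arbitrary \<open>s\<close>. Starting from an arbitrary \<open>x\<^sub>1\<close>, for which \<open>1/x\<^sub>1 = 1/x\<^sub>1\<close>, and
  iterating with \<open>s = 1\<close>, this yields solutions with \<open>x\<^sub>1\<close> as large as desired; a large \<open>x\<^sub>1\<close> makes
  \<open>P\<close> large, which keeps the appended entries away from \<open>0\<close> and \<open>\<plusminus>1\<close>.
\<close>

lemma prod_mult_sum_inverse:
  fixes x :: "'a \<Rightarrow> int"
  assumes "finite A" "\<And>i. i \<in> A \<Longrightarrow> x i \<noteq> 0"
  shows "(\<Prod>i\<in>A. of_int (x i)) * (\<Sum>i\<in>A. 1 / of_int (x i))
       = (of_int (\<Sum>i\<in>A. \<Prod>j\<in>A - {i}. x j) :: rat)"
proof -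
  have "(\<Prod>j\<in>A. of_int (x j)) * (1 / of_int (x i)) = (of_int (\<Prod>j\<in>A - {i}. x j) :: rat)"
    if "i \<in> A" for i
    using assms that by (simp add: prod.remove [of A i])
  then show ?thesis
    by (simp add: sum_distrib_left)
qed

lemma solutions_imp_dvd:
  assumes "x \<in> solutions n r s"
  shows "r dvd s"
proof -
  have nz: "x i \<noteq> 0" if "i \<in> {1..n}" for i
    using assms that by (auto simp: solutions_def PiE_iff)
  let ?P = "\<Prod>i=1..n. of_int (x i) :: rat"
  have "?P \<noteq> 0"
    using nz by simp
  then have "of_int s = of_int r * (?P * (\<Sum>i=1..n. 1 / of_int (x i)))"
    using assms by (simp add: solutions_def field_simps)
  also have "\<dots> = of_int (r * (\<Sum>i=1..n. \<Prod>j\<in>{1..n} - {i}. x j))"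
    using prod_mult_sum_inverse [of "{1..n}" x] nz by simp
  finally show ?thesis
    by (metis dvd_triv_left of_int_eq_iff)
qed

text \<open>With \<open>P\<close> the product of the old entries, their reciprocals sum to
  \<open>1 / P\<close>, and \<open>1 / P + 1 / (s - P) = s / (P * (s - P))\<close>.\<close>

lemma solutions_append:
  assumes x: "x \<in> solutions n 1 1" and nz: "s - (\<Prod>i=1..n. x i) \<noteq> 0"
  shows "x(Suc n := s - (\<Prod>i=1..n. x i)) \<in> solutions (Suc n) 1 s"
proof -
  define y where "y = s - (\<Prod>i=1..n. x i)"
  have xE: "x \<in> {1..n} \<rightarrow>\<^sub>E (UNIV - {0})"
    using x by (simp add: solutions_def)
  let ?P = "\<Prod>i=1..n. of_int (x i) :: rat" and ?S = "\<Sum>i=1..n. 1 / of_int (x i) :: rat"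
  have P: "?P \<noteq> 0"
    using xE by (auto simp: PiE_iff)
  have S: "?S = 1 / ?P"
    using x by (simp add: solutions_def)
  have y: "of_int y = of_int s - ?P"
    by (simp add: y_def)
  have y0: "of_int y \<noteq> (0 :: rat)"
    using nz unfolding y_def of_int_eq_0_iff .
  have "?S + 1 / of_int y = of_int s / (?P * of_int y)"
    unfolding S using P y0 by (simp add: field_simps y)
  moreover have "x(Suc n := y) \<in> {1..Suc n} \<rightarrow>\<^sub>E (UNIV - {0})"
    using xE nz by (simp add: y_def atLeastAtMostSuc_conv fun_upd_in_PiE PiE_fun_upd)
  ultimately show ?thesis
    unfolding y_def [symmetric] by (simp add: solutions_def)
qed

text \<open>The entries after the first have a nonzero integer product, so the full product is at
  least as large as \<open>x 1\<close> in absolute value and stays at distance at least 2 from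
  \<open>s\<close>. Keeping \<open>x 1\<close> lets its size carry over to the longer tuple.\<close>

lemma solutions_append_bounded:
  assumes x: "x \<in> solutions n 1 1" and ge2: "\<forall>i\<in>{1..n}. \<bar>x i\<bar> \<ge> 2"
    and n: "n \<ge> 1" and large: "\<bar>x 1\<bar> \<ge> \<bar>s\<bar> + 2"
  shows "\<exists>y \<in> solutions (Suc n) 1 s. (\<forall>i\<in>{1..Suc n}. \<bar>y i\<bar> \<ge> 2) \<and> y 1 = x 1"
proof -
  let ?P = "\<Prod>i=1..n. x i"
  let ?Q = "\<Prod>i\<in>{1..n} - {1}. x i"
  have "?Q \<noteq> 0"
    using ge2 by force
  then have "\<bar>?Q\<bar> \<ge> 1"
    by linarith
  then have "\<bar>x 1\<bar> * 1 \<le> \<bar>x 1\<bar> * \<bar>?Q\<bar>"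
    by (intro mult_left_mono) auto
  also have "\<dots> = \<bar>?P\<bar>"
    using n prod.remove [of "{1..n}" 1 x] by (simp add: abs_mult)
  finally have ge: "\<bar>s - ?P\<bar> \<ge> 2"
    using large by linarith
  then have "x(Suc n := s - ?P) \<in> solutions (Suc n) 1 s"
    using x by (intro solutions_append) auto
  moreover have "\<forall>i\<in>{1..Suc n}. \<bar>(x(Suc n := s - ?P)) i\<bar> \<ge> 2"
    using ge2 ge by (auto simp: le_Suc_eq)
  ultimately show ?thesis
    using n by (intro bexI [of _ "x(Suc n := s - ?P)"]) auto
qed

lemma unbounded_unit_solutions:
  assumes "n \<ge> 1"
  shows "\<exists>x \<in> solutions n 1 1. (\<forall>i\<in>{1..n}. \<bar>x i\<bar> \<ge> 2) \<and> \<bar>x 1\<bar> \<ge> N"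
  using assms
proof (induction n arbitrary: N rule: dec_induct)
  case base
  let ?x = "\<lambda>i\<in>{1..1}. \<bar>N\<bar> + 2"
  have "?x \<in> solutions 1 1 1"
    by (auto simp: solutions_def)
  then show ?case
    by (intro bexI [of _ ?x]) auto
next
  case (step n)
  \<comment> \<open>The \<open>3\<close> is the size \<open>\<bar>s\<bar> + 2\<close> required for
    appending with \<open>s = 1\<close>.\<close>
  obtain x where "x \<in> solutions n 1 1" "\<forall>i\<in>{1..n}. \<bar>x i\<bar> \<ge> 2" "\<bar>x 1\<bar> \<ge> max N 3"
    using step.IH [of "max N 3"] by blast
  then show ?case
    using solutions_append_bounded [of x n 1] step.hyps by auto
qed

lemma unbounded_solutions:
  assumes "n \<ge> 2"
  shows "\<exists>x \<in> solutions n 1 s. (\<forall>i\<in>{1..n}. \<bar>x i\<bar> \<ge> 2) \<and> \<bar>x 1\<bar> \<ge> N"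
proof -
  obtain m where m: "n = Suc m" "m \<ge> 1"
    using assms by (cases n) auto
  \<comment> \<open>Only the last appended entry brings in the given \<open>s\<close>.\<close>
  obtain x where "x \<in> solutions m 1 1" "\<forall>i\<in>{1..m}. \<bar>x i\<bar> \<ge> 2" "\<bar>x 1\<bar> \<ge> max N (\<bar>s\<bar> + 2)"
    using unbounded_unit_solutions [OF m(2)] by blast
  then show ?thesis
    using solutions_append_bounded [of x m s] m by auto
qed

theorem theorem4p1:
  fixes n :: nat and r s :: int
  assumes "n \<ge> 2" and "r \<noteq> 0" and "s \<noteq> 0" and "r > 0" and "gcd r s = 1"
  shows "(r > 1 \<longrightarrow> solutions n r s = {}) \<and>
         (r = 1 \<longrightarrow> infinite (solutions n r s) \<and>
            infinite {x \<in> solutions n r s. (MIN i\<in>{1..n}. \<bar>x i\<bar>) \<ge> 2})"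
proof -
  let ?B = "{x \<in> solutions n 1 s. (MIN i\<in>{1..n}. \<bar>x i\<bar>) \<ge> 2}"
  have "solutions n r s = {}" if "r > 1"
  proof (rule equals0I)
    fix x assume "x \<in> solutions n r s"
    then have "gcd r s = \<bar>r\<bar>"
      by (simp add: solutions_imp_dvd)
    then show False
      using assms that by simp
  qed
  moreover have inf: "infinite ?B"
  proof
    assume fin: "finite ?B"
    \<comment> \<open>If \<open>?B\<close> were finite, its first entries would be bounded.\<close>
    define M where "M = Max (insert 0 ((\<lambda>x. \<bar>x 1\<bar>) ` ?B))"
    have le: "\<bar>x 1\<bar> \<le> M" if "x \<in> ?B" for x
      unfolding M_def using fin that by (intro Max_ge) auto
    obtain x where "x \<in> solutions n 1 s" "\<forall>i\<in>{1..n}. \<bar>x i\<bar> \<ge> 2" and x1: "\<bar>x 1\<bar> \<ge> M + 1"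
      using unbounded_solutions [OF assms(1)] by blast
    then have "x \<in> ?B"
      using assms(1) by simp
    then show False
      using le x1 by fastforce
  qed
  moreover have "infinite (solutions n 1 s)"
    using inf by (rule contrapos_nn) simp
  ultimately show ?thesis
    by blast
qed

end
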